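(* Let $\nu$ be a probability measure on $\mathrm{U}(d)$ which is a $\delta$-approximate unitary $k$-expander. Then for every $\mathcal{V}\in\mathcal{U}(d)$, every $\epsilon\in[0,2]$ and every $\Phi\in\mathcal{H}_k$ with $\int_{\mathcal{U}(d)}\mathrm{d}\mu(\mathcal{U})\,\Phi(\mathcal{U})=1$, $$\left|\int_{B(\mathcal{V},\epsilon)}\mathrm{d}\mu(\mathcal{U})(T_\nu\Phi)(\mathcal{U})-\mathrm{vol}(B(\mathcal{V},\epsilon))\right|\le\delta\sqrt{\mathrm{vol}(B(\mathcal{V},\epsilon))}\,\|\Phi\|_2 .$$
   Context: $\mathcal{U}(d)$: unitary channels on $\mathbb{C}^d$ (functions on it = phase-invariant functions on $\mathrm{U}(d)$); $\mu$ the Haar probability measure, $\mathrm{vol}=\mu$, $\|\cdot\|_2$ the $L^2(\mu)$ norm. $\mathrm{D}(\mathcal{U},\mathcal{V})=\min_\varphi\|U-e^{i\varphi}V\|_\infty$, $B(\mathcal{V},\epsilon)=\{\mathcal{U}:\mathrm{D}(\mathcal{U},\mathcal{V})\le\epsilon\}$. $\mathcal{H}_k$ is the span of $U\mapsto\mathrm{tr}(A\,U^{\otimes s}\otimes\bar U^{\otimes s})$, $0\le s\le k$. $(T_\nu\Phi)(U)=\int\mathrm{d}\nu(V)\Phi(V^{-1}U)$. $\nu$ is a $\delta$-approximate $k$-expander if $\|T_{\nu,k}-T_{\mu,k}\|_\infty\le\delta$, with $T_{\nu,k}=\int\mathrm{d}\nu(U)\,U^{\otimes k}\otimes\bar U^{\otimes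 k}$. *)

theory Defs
  imports "HOL-Probability.Probability"
begin

text \<open>Matrices on C^d are modelled as complex^'n^'n with d = CARD('n).\<close>

definition cadj :: "complex^'n^'n \<Rightarrow> complex^'n^'n" where
  "cadj U = (\<chi> i j. cnj (U $ j $ i))"

definition unitary :: "complex^'n^'n \<Rightarrow> bool" where
  "unitary U \<longleftrightarrow> U ** cadj U = mat 1 \<and> cadj U ** U = mat 1"

text \<open>Operator norm: onorm of x \<mapsto> A x on complex^'n with the Euclidean norm.
  D(U,V) = min over phases of the operator norm of U - e^{i phi} V.\<close>
definition Dist :: "complex^'n^'n \<Rightarrow> complex^'n^'n \<Rightarrow> real" where
  "Dist U V = (INF \<phi>::real. onorm (\<lambda>x::complex^'n. U *v x - exp (\<i> * of_real \<phi>) *s (V *v x)))"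

definition ballD :: "complex^'n^'n \<Rightarrow> real \<Rightarrow> (complex^'n^'n) set" where
  "ballD V \<epsilon> = {U. unitary U \<and> Dist U V \<le> \<epsilon>}"

text \<open>Haar probability measure on U(d) (as a measure on the matrix space, concentrated on U(d),
  left and right invariant).\<close>
definition haar :: "(complex^'n^'n) measure \<Rightarrow> bool" where
  "haar \<mu> \<longleftrightarrow> prob_space \<mu> \<and> sets \<mu> = sets borel \<and> (AE U in \<mu>. unitary U) \<and>
     (\<forall>W. unitary W \<longrightarrow> distr \<mu> borel (\<lambda>U. W ** U) = \<mu> \<and> distr \<mu> borel (\<lambda>U. U ** W) = \<mu>)"

text \<open>Multi-indices of length 2s index the entries of U^{\<otimes>s} \<otimes> conj(U)^{\<otimes>s}.\<close>
definition idx :: "nat \<Rightarrow> 'n list set" where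
  "idx s = {I. length I = 2 * s}"

definition tens_entry :: "nat \<Rightarrow> complex^'n^'n \<Rightarrow> 'n list \<Rightarrow> 'n list \<Rightarrow> complex" where
  "tens_entry s U I J = (\<Prod>l<s. U $ (I ! l) $ (J ! l)) * (\<Prod>l<s. cnj (U $ (I ! (s + l)) $ (J ! (s + l))))"

text \<open>U \<mapsto> tr(A U^{\<otimes>s} \<otimes> conj(U)^{\<otimes>s}).\<close>
definition hk_gen :: "nat \<Rightarrow> ('n list \<Rightarrow> 'n list \<Rightarrow> complex) \<Rightarrow> complex^'n^'n \<Rightarrow> complex" where
  "hk_gen s A U = (\<Sum>I\<in>idx s. \<Sum>J\<in>idx s. A I J * tens_entry s U J I)"

text \<open>H_k: complex linear span of the generators with 0 \<le> s \<le> k.\<close>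
inductive_set Hk :: "nat \<Rightarrow> (complex^'n^'n \<Rightarrow> complex) set" for k where
  zero: "(\<lambda>U. 0) \<in> Hk k"
| gen: "s \<le> k \<Longrightarrow> (\<lambda>U. c * hk_gen s A U) \<in> Hk k"
| add: "f \<in> Hk k \<Longrightarrow> g \<in> Hk k \<Longrightarrow> (\<lambda>U. f U + g U) \<in> Hk k"

text \<open>Operator norm of a matrix indexed by a finite set S.\<close>
definition opnorm :: "'i set \<Rightarrow> ('i \<Rightarrow> 'i \<Rightarrow> complex) \<Rightarrow> real" where
  "opnorm S M = Sup {sqrt (\<Sum>i\<in>S. (cmod (\<Sum>j\<in>S. M i j * x j))\<^sup>2) | x.
                      (\<Sum>j\<in>S. (cmod (x j))\<^sup>2) \<le> 1}"

text \<open>T_{\<nu>,k} = \<integral> d\<nu>(U) U^{\<otimes>k} \<otimes> conj(U)^{\<otimes>k}, entrywise.\<close>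
definition Tmom :: "(complex^'n^'n) measure \<Rightarrow> nat \<Rightarrow> 'n list \<Rightarrow> 'n list \<Rightarrow> complex" where
  "Tmom \<nu> k I J = (\<integral>U. tens_entry k U I J \<partial>\<nu>)"

definition approx_expander ::
  "(complex^'n^'n) measure \<Rightarrow> (complex^'n^'n) measure \<Rightarrow> real \<Rightarrow> nat \<Rightarrow> bool" where
  "approx_expander \<mu> \<nu> \<delta> k \<longleftrightarrow> opnorm (idx k) (\<lambda>I J. Tmom \<nu> k I J - Tmom \<mu> k I J) \<le> \<delta>"

definition Tnu :: "(complex^'n^'n) measure \<Rightarrow> (complex^'n^'n \<Rightarrow> complex) \<Rightarrow> complex^'n^'n \<Rightarrow> complex" where
  "Tnu \<nu> \<Phi> U = (\<integral>V. \<Phi> (cadj V ** U) \<partial>\<nu>)"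

definition L2norm :: "(complex^'n^'n) measure \<Rightarrow> (complex^'n^'n \<Rightarrow> complex) \<Rightarrow> real" where
  "L2norm \<mu> \<Phi> = sqrt (\<integral>U. (cmod (\<Phi> U))\<^sup>2 \<partial>\<mu>)"

end

theory Submission
  imports Defs
begin

text \<open>On \<open>U(d)\<close> every \<open>\<Phi> \<in> H\<^sub>k\<close> is a polynomial \<open>U \<mapsto> \<Sum>\<^sub>a\<^sub>b C\<^sub>a\<^sub>b (U\<^sup>\<otimes>\<^sup>k \<otimes> \<bar>U\<^sup>\<otimes>\<^sup>k)\<^sub>a\<^sub>b\<close> of
  degree exactly \<open>k\<close>. In these coordinates \<open>T\<^sub>\<nu>\<close> multiplies \<open>C\<close> by the conjugate moment
  matrix \<open>conj T\<^sub>\<nu>\<^sub>,\<^sub>k\<close>, and by invariance of the Haar measure \<open>T\<^sub>\<mu>\<Phi>\<close> is the constant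
  \<open>\<integral>\<Phi> d\<mu> = 1\<close>. Hence \<open>T\<^sub>\<nu>\<Phi> - 1\<close> is the polynomial with coefficients \<open>conj \<Delta> C\<close>,
  \<open>\<Delta> = T\<^sub>\<nu>\<^sub>,\<^sub>k - T\<^sub>\<mu>\<^sub>,\<^sub>k\<close>, and Cauchy-Schwarz on the ball reduces the claim to
  \<open>\<parallel>conj \<Delta> C\<parallel>\<^sub>2 \<le> \<parallel>\<Delta>\<parallel> \<parallel>C\<parallel>\<^sub>2\<close> for the \<open>L\<^sup>2(\<mu>)\<close> norms of the polynomials. Left
  invariance of \<open>\<mu>\<close> makes multiplication by \<open>\<Delta>\<^sup>T\<close> the \<open>L\<^sup>2(\<mu>)\<close>-adjoint of
  multiplication by \<open>conj \<Delta>\<close>. Applying the two alternately to \<open>C\<close> gives squared norms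
  \<open>s\<^sub>n\<close> that are log-convex (Cauchy-Schwarz plus adjointness) and grow at most like
  \<open>\<parallel>\<Delta>\<parallel>\<^sup>2\<^sup>n\<close> (bounding them by Frobenius norms of coefficients), which forces
  \<open>s\<^sub>1 \<le> \<parallel>\<Delta>\<parallel>\<^sup>2 s\<^sub>0\<close>.\<close>

section \<open>Finite sums and products\<close>

lemma prod_sum_eq_sum_lists:
  fixes f :: "nat \<Rightarrow> 'a::finite \<Rightarrow> 'b::comm_semiring_1"
  shows "(\<Prod>l<n. \<Sum>m\<in>UNIV. f l m) = (\<Sum>c\<in>{c. length c = n}. \<Prod>l<n. f l (c ! l))"
proof (induction n)
  case 0
  have "{c::'a list. length c = 0} = {[]}" by auto
  then show ?case by simp
next
  case (Suc n)
  let ?snoc = "\<lambda>(c, m). c @ [m]"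
  have snoc_image: "{c::'a list. length c = Suc n} = ?snoc ` ({c. length c = n} \<times> UNIV)"
  proof (intro set_eqI iffI)
    fix x :: "'a list" assume "x \<in> {c. length c = Suc n}"
    then have "x = butlast x @ [last x]" "length (butlast x) = n"
      by (auto intro!: append_butlast_last_id[symmetric])
    then show "x \<in> ?snoc ` ({c. length c = n} \<times> UNIV)"
      by (metis (mono_tags, lifting) SigmaI UNIV_I case_prod_conv image_eqI mem_Collect_eq)
  qed auto
  have "inj_on ?snoc ({c::'a list. length c = n} \<times> UNIV)"
    by (auto simp: inj_on_def)
  then have "(\<Sum>c\<in>{c. length c = Suc n}. \<Prod>l<Suc n. f l (c ! l))
      = (\<Sum>(c, m)\<in>{c. length c = n} \<times> UNIV. \<Prod>l<Suc n. f l ((c @ [m]) ! l))"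
    unfolding snoc_image by (subst sum.reindex) (simp_all add: case_prod_unfold)
  also have "\<dots> = (\<Sum>(c, m)\<in>{c. length c = n} \<times> UNIV. (\<Prod>l<n. f l (c ! l)) * f n m)"
    by (rule sum.cong[OF refl]) (auto simp: nth_append intro!: prod.cong)
  also have "\<dots> = (\<Prod>l<Suc n. \<Sum>m\<in>UNIV. f l m)"
    by (simp add: Suc sum_product sum.cartesian_product)
  finally show ?case ..
qed

lemma prod_lessThan_add:
  fixes F :: "nat \<Rightarrow> 'b::comm_monoid_mult"
  shows "(\<Prod>l<m + n. F l) = (\<Prod>l<m. F l) * (\<Prod>l<n. F (m + l))"
proof -
  have "{..<m + n} = {..<m} \<union> {m..<m + n}" by auto
  moreover have "prod F ({..<m} \<union> {m..<m + n}) = prod F {..<m} * prod F {m..<m + n}"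
    by (rule prod.union_disjoint) auto
  ultimately have "(\<Prod>l<m + n. F l) = (\<Prod>l<m. F l) * (\<Prod>l\<in>{m..<m + n}. F l)"
    by simp
  also have "(\<Prod>l\<in>{m..<m + n}. F l) = (\<Prod>l<n. F (m + l))"
    using prod.shift_bounds_nat_ivl[of F 0 m n] by (simp add: lessThan_atLeast0 add.commute)
  finally show ?thesis .
qed

lemma sum_sum_if_eq:
  fixes c :: "'a::semiring_0"
  assumes "finite A" "finite B" "x0 \<in> A" "y0 \<in> B"
  shows "(\<Sum>x\<in>A. \<Sum>y\<in>B. (if x = x0 \<and> y = y0 then c else 0) * f x y) = c * f x0 y0"
proof -
  have "(\<Sum>x\<in>A. \<Sum>y\<in>B. (if x = x0 \<and> y = y0 then c else 0) * f x y)
      = (\<Sum>x\<in>A. if x = x0 then (\<Sum>y\<in>B. if y = y0 then c * f x y else 0) else 0)"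
    by (rule sum.cong[OF refl]) (auto intro!: sum.cong)
  then show ?thesis using assms by simp
qed

lemma norm_sum_mult_squared_le:
  fixes a b :: "'i \<Rightarrow> complex"
  shows "(cmod (\<Sum>j\<in>S. a j * b j))\<^sup>2 \<le> (\<Sum>j\<in>S. (cmod (a j))\<^sup>2) * (\<Sum>j\<in>S. (cmod (b j))\<^sup>2)"
proof -
  have "cmod (\<Sum>j\<in>S. a j * b j) \<le> (\<Sum>j\<in>S. cmod (a j) * cmod (b j))"
    by (rule order_trans[OF norm_sum]) (simp add: norm_mult)
  then have "(cmod (\<Sum>j\<in>S. a j * b j))\<^sup>2 \<le> (\<Sum>j\<in>S. cmod (a j) * cmod (b j))\<^sup>2"
    by (rule power_mono) simp
  also have "\<dots> \<le> (\<Sum>j\<in>S. (cmod (a j))\<^sup>2) * (\<Sum>j\<in>S. (cmod (b j))\<^sup>2)"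
    by (rule Cauchy_Schwarz_ineq_sum)
  finally show ?thesis .
qed

lemma norm_vec_squared: "(norm x)\<^sup>2 = (\<Sum>i\<in>UNIV. (norm (x $ i))\<^sup>2)"
  by (simp add: norm_vec_def L2_set_def sum_nonneg)

lemma norm_matrix_vector_mult_le:
  fixes A :: "complex^'n^'m"
  shows "norm (A *v x) \<le> norm A * norm x"
proof -
  have "(norm (A *v x))\<^sup>2 = (\<Sum>i\<in>UNIV. (cmod (\<Sum>j\<in>UNIV. A $ i $ j * x $ j))\<^sup>2)"
    by (simp add: norm_vec_squared matrix_vector_mult_def)
  also have "\<dots> \<le> (\<Sum>i\<in>UNIV. (norm (A $ i))\<^sup>2 * (norm x)\<^sup>2)"
    by (rule sum_mono) (simp add: norm_vec_squared[of "A $ _"] norm_vec_squared[of x]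
        norm_sum_mult_squared_le)
  also have "\<dots> = (norm A * norm x)\<^sup>2"
    by (simp add: norm_vec_squared[of A] power_mult_distrib sum_distrib_right)
  finally show ?thesis
    by (rule power2_le_imp_le) simp
qed

section \<open>Unitary matrices\<close>

lemma cadj_cadj [simp]: "cadj (cadj A) = A"
  by (simp add: cadj_def vec_eq_iff)

lemma cadj_mult: "cadj (A ** B) = cadj B ** cadj A"
  by (simp add: cadj_def vec_eq_iff matrix_matrix_mult_def cnj_sum mult.commute)

lemma unitary_cadj: "unitary U \<Longrightarrow> unitary (cadj U)"
  by (simp add: unitary_def)

lemma unitary_mult: "unitary A \<Longrightarrow> unitary B \<Longrightarrow> unitary (A ** B)"
  unfolding unitary_def cadj_mult by (metis matrix_mul_assoc matrix_mul_lid)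

lemma unitary_cadj_mult_cancel: "unitary W \<Longrightarrow> cadj W ** (W ** U) = U"
  by (metis matrix_mul_assoc matrix_mul_lid unitary_def)

lemma unitary_row_sum_squares:
  assumes "unitary U"
  shows "(\<Sum>j\<in>UNIV. U $ i $ j * cnj (U $ i $ j)) = 1"
proof -
  have "(U ** cadj U) $ i $ i = 1"
    using assms by (simp add: unitary_def mat_def)
  then show ?thesis
    by (simp add: matrix_matrix_mult_def cadj_def)
qed

lemma norm_unitary_row:
  assumes "unitary U"
  shows "norm (U $ i) = 1"
proof -
  have "complex_of_real (\<Sum>j\<in>UNIV. (cmod (U $ i $ j))\<^sup>2) = 1"
    unfolding of_real_sum complex_norm_square by (rule unitary_row_sum_squares[OF assms])
  then show ?thesis
    by (simp only: of_real_eq_1_iff norm_vec_def L2_set_def real_sqrt_one)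
qed

lemma norm_unitary_entry_le:
  assumes "unitary U"
  shows "cmod (U $ i $ j) \<le> 1"
proof -
  have "cmod (U $ i $ j) \<le> norm (U $ i)"
    by (rule Finite_Cartesian_Product.norm_nth_le)
  then show ?thesis
    by (simp add: norm_unitary_row[OF assms])
qed

lemma unitary_sum_squares:
  fixes U :: "complex^'n^'n"
  assumes "unitary U"
  shows "(\<Sum>i\<in>UNIV. \<Sum>j\<in>UNIV. U $ i $ j * cnj (U $ i $ j)) = of_nat CARD('n)"
  by (simp add: unitary_row_sum_squares[OF assms])

lemma continuous_on_matrix_mult [continuous_intros]:
  fixes f g :: "'x::topological_space \<Rightarrow> complex^'n^'n"
  assumes "continuous_on S f" "continuous_on S g"
  shows "continuous_on S (\<lambda>x. f x ** g x)"
  unfolding matrix_matrix_mult_def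
  by (intro continuous_on_vec_lambda continuous_on_sum continuous_on_mult
      continuous_on_component assms)

lemma continuous_on_cadj [continuous_intros]:
  fixes f :: "'x::topological_space \<Rightarrow> complex^'n^'n"
  assumes "continuous_on S f"
  shows "continuous_on S (\<lambda>x. cadj (f x))"
  unfolding cadj_def
  by (intro continuous_on_vec_lambda continuous_on_cnj continuous_on_component assms)

lemma compact_unitary: "compact {U::complex^'n^'n. unitary U}"
proof (rule compact_eq_bounded_closed[THEN iffD2], rule conjI)
  have "norm U = sqrt CARD('n)" if "unitary U" for U :: "complex^'n^'n"
    using norm_unitary_row[OF that] by (simp add: norm_vec_def L2_set_def)
  then show "bounded {U::complex^'n^'n. unitary U}"
    by (auto simp: bounded_iff)
  have "{U::complex^'n^'n. unitary U} = {U. U ** cadj U = mat 1} \<inter> {U. cadj U ** U = mat 1}"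
    unfolding unitary_def by auto
  then show "closed {U::complex^'n^'n. unitary U}"
    by (auto intro!: closed_Int closed_Collect_eq continuous_intros)
qed

section \<open>The ball \<open>B(V, \<epsilon>)\<close>\<close>

definition phase_dist :: "complex^'n^'n \<Rightarrow> real \<Rightarrow> complex^'n^'n \<Rightarrow> real" where
  "phase_dist V \<phi> U = onorm (\<lambda>x::complex^'n. U *v x - exp (\<i> * of_real \<phi>) *s (V *v x))"

lemma phase_dist_eq:
  fixes V :: "complex^'n::finite^'n"
  shows "phase_dist V \<phi> U = onorm ((*v) (U - (\<chi> i j. exp (\<i> * of_real \<phi>) * V $ i $ j)))"
proof -
  have "(\<lambda>x::complex^'n. U *v x - exp (\<i> * of_real \<phi>) *s (V *v x))
      = (*v) (U - (\<chi> i j. exp (\<i> * of_real \<phi>) * V $ i $ j))"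
    by (rule ext) (simp add: vec_eq_iff matrix_vector_mult_def
        sum_distrib_left mult_ac right_diff_distrib sum_subtractf)
  then show ?thesis unfolding phase_dist_def by simp
qed

lemma phase_dist_le:
  fixes V :: "complex^'n::finite^'n"
  shows "phase_dist V \<phi> U \<le> phase_dist V \<phi> U' + norm (U - U')"
proof -
  define E :: "complex^'n^'n" where "E = (\<chi> i j. exp (\<i> * of_real \<phi>) * V $ i $ j)"
  have "(*v) (U - E) = (\<lambda>x. (U' - E) *v x + (U - U') *v x)"
    by (rule ext) (simp add: matrix_vector_mult_diff_rdistrib)
  then have "onorm ((*v) (U - E)) \<le> onorm ((*v) (U' - E)) + onorm ((*v) (U - U'))"
    using onorm_triangle[OF matrix_vector_mul_bounded_linear matrix_vector_mul_bounded_linear] by metis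
  also have "onorm ((*v) (U - U')) \<le> norm (U - U')"
    by (rule onorm_le) (rule norm_matrix_vector_mult_le)
  finally show ?thesis
    unfolding phase_dist_eq E_def by simp
qed

lemma Dist_le_Dist_add_norm: "Dist U V \<le> Dist U' V + norm (U - U')"
proof -
  have bdd: "bdd_below (range (\<lambda>\<phi>. phase_dist V \<phi> U))"
    by (rule bdd_belowI[of _ 0]) (auto simp: phase_dist_eq intro: onorm_pos_le matrix_vector_mul_bounded_linear)
  have "Dist U V - norm (U - U') \<le> phase_dist V \<phi> U'" for \<phi>
    using cInf_lower[OF rangeI bdd, of \<phi>] phase_dist_le[of V \<phi> U U']
    by (simp add: Dist_def phase_dist_def)
  then have "Dist U V - norm (U - U') \<le> Dist U' V"
    unfolding Dist_def phase_dist_def[symmetric] by (intro cInf_greatest) auto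
  then show ?thesis by simp
qed

lemma continuous_on_Dist: "continuous_on UNIV (\<lambda>U. Dist U V)"
proof (rule lipschitz_on_continuous_on, rule lipschitz_onI)
  show "dist (Dist U V) (Dist U' V) \<le> 1 * dist U U'" for U U'
    using Dist_le_Dist_add_norm[of U V U'] Dist_le_Dist_add_norm[of U' V U] by (simp add: dist_real_def dist_norm norm_minus_commute)
qed simp

lemma ballD_borel: "ballD V \<epsilon> \<in> sets borel"
proof -
  have "ballD V \<epsilon> = {U. unitary U} \<inter> {U. Dist U V \<le> \<epsilon>}"
    unfolding ballD_def by auto
  also have "closed \<dots>"
    by (intro closed_Int compact_imp_closed compact_unitary closed_Collect_le
        continuous_on_Dist continuous_on_const)
  finally show ?thesis by simp
qed

section \<open>Entries of tensor powers\<close>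

definition tens_factor :: "nat \<Rightarrow> complex^'n^'n \<Rightarrow> 'n list \<Rightarrow> 'n list \<Rightarrow> nat \<Rightarrow> complex" where
  "tens_factor k U a b l = (if l < k then U $ (a ! l) $ (b ! l) else cnj (U $ (a ! l) $ (b ! l)))"

lemma tens_entry_eq_prod: "tens_entry k U a b = (\<Prod>l<2 * k. tens_factor k U a b l)"
  unfolding tens_entry_def tens_factor_def mult_2 prod_lessThan_add by simp

lemma finite_idx [simp]: "finite (idx k :: 'n::finite list set)"
  unfolding idx_def using finite_lists_length_eq[of "UNIV :: 'n set"] by simp

lemma tens_entry_mult:
  fixes A B :: "complex^'n^'n"
  shows "tens_entry k (A ** B) a b = (\<Sum>c\<in>idx k. tens_entry k A a c * tens_entry k B c b)"
proof -
  define F where "F l m = (if l < k then A $ (a ! l) $ m * B $ m $ (b ! l)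
      else cnj (A $ (a ! l) $ m) * cnj (B $ m $ (b ! l)))" for l m
  have "tens_factor k (A ** B) a b l = (\<Sum>m\<in>UNIV. F l m)" for l
    by (simp add: tens_factor_def F_def matrix_matrix_mult_def cnj_sum)
  then have "tens_entry k (A ** B) a b = (\<Prod>l<2 * k. \<Sum>m\<in>UNIV. F l m)"
    by (simp add: tens_entry_eq_prod)
  also have "\<dots> = (\<Sum>c\<in>idx k. \<Prod>l<2 * k. F l (c ! l))"
    unfolding prod_sum_eq_sum_lists idx_def ..
  also have "\<dots> = (\<Sum>c\<in>idx k. tens_entry k A a c * tens_entry k B c b)"
    by (rule sum.cong) (auto simp: tens_entry_eq_prod F_def tens_factor_def
        prod.distrib[symmetric] intro!: prod.cong)
  finally show ?thesis .
qed

lemma tens_entry_cadj: "tens_entry k (cadj V) a b = cnj (tens_entry k V b a)"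
  by (simp add: tens_entry_def cadj_def cnj_prod)

lemma norm_tens_entry_le: "unitary U \<Longrightarrow> cmod (tens_entry k U a b) \<le> 1"
  unfolding tens_entry_def norm_mult prod_norm[symmetric]
  by (intro mult_le_one prod_le_1 prod_nonneg) (auto simp: norm_unitary_entry_le)

lemma continuous_on_tens_entry [continuous_intros]:
  "continuous_on S f \<Longrightarrow> continuous_on S (\<lambda>x. tens_entry k (f x) a b)"
  unfolding tens_entry_def
  by (intro continuous_on_mult continuous_on_prod continuous_on_cnj continuous_on_component)

definition idx_extend :: "nat \<Rightarrow> 'n list \<Rightarrow> 'n \<Rightarrow> 'n list" where
  "idx_extend m a p = take m a @ [p] @ drop m a @ [p]"

lemma idx_extend_in_idx: "a \<in> idx m \<Longrightarrow> idx_extend m a p \<in> idx (Suc m)"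
  by (simp add: idx_def idx_extend_def)

lemma tens_entry_idx_extend:
  assumes a: "a \<in> idx m" and b: "b \<in> idx m"
  shows "tens_entry (Suc m) U (idx_extend m a p) (idx_extend m b q)
    = tens_entry m U a b * (U $ p $ q * cnj (U $ p $ q))"
proof -
  have nth: "l < m \<Longrightarrow> idx_extend m c r ! l = c ! l"
    "idx_extend m c r ! m = r"
    "l < m \<Longrightarrow> idx_extend m c r ! Suc (m + l) = c ! (m + l)"
    "idx_extend m c r ! Suc (m + m) = r"
    if "c \<in> idx m" for c :: "'a list" and r l
    using that by (auto simp: idx_def idx_extend_def nth_append)
  have "(\<Prod>l<m. U $ (idx_extend m a p ! l) $ (idx_extend m b q ! l))
      = (\<Prod>l<m. U $ (a ! l) $ (b ! l))"
    "(\<Prod>l<m. cnj (U $ (idx_extend m a p ! (Suc m + l)) $ (idx_extend m b q ! (Suc m + l))))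
      = (\<Prod>l<m. cnj (U $ (a ! (m + l)) $ (b ! (m + l))))"
    by (auto simp: nth[OF a] nth[OF b] intro!: prod.cong)
  then show ?thesis
    unfolding tens_entry_def prod.lessThan_Suc
    by (simp add: nth[OF a] nth[OF b] mult_ac)
qed

section \<open>Matrices indexed by a finite set\<close>

definition mmult :: "'i set \<Rightarrow> ('i \<Rightarrow> 'i \<Rightarrow> complex) \<Rightarrow> ('i \<Rightarrow> 'i \<Rightarrow> complex) \<Rightarrow> 'i \<Rightarrow> 'i \<Rightarrow> complex"
  where "mmult S M C = (\<lambda>a b. \<Sum>c\<in>S. M a c * C c b)"

definition frob_sq :: "'i set \<Rightarrow> ('i \<Rightarrow> 'i \<Rightarrow> complex) \<Rightarrow> real" where
  "frob_sq S C = (\<Sum>a\<in>S. \<Sum>b\<in>S. (cmod (C a b))\<^sup>2)"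

lemma frob_sq_nonneg: "0 \<le> frob_sq S C"
  unfolding frob_sq_def by (intro sum_nonneg) simp

lemma norm_mult_vec_squared_le_frob_sq:
  assumes "(\<Sum>j\<in>S. (cmod (x j))\<^sup>2) \<le> 1"
  shows "(\<Sum>i\<in>S. (cmod (\<Sum>j\<in>S. M i j * x j))\<^sup>2) \<le> frob_sq S M"
proof -
  have "(\<Sum>i\<in>S. (cmod (\<Sum>j\<in>S. M i j * x j))\<^sup>2)
      \<le> (\<Sum>i\<in>S. (\<Sum>j\<in>S. (cmod (M i j))\<^sup>2) * (\<Sum>j\<in>S. (cmod (x j))\<^sup>2))"
    by (intro sum_mono norm_sum_mult_squared_le)
  also have "\<dots> \<le> (\<Sum>i\<in>S. (\<Sum>j\<in>S. (cmod (M i j))\<^sup>2))"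
    by (intro sum_mono mult_left_le assms sum_nonneg) simp
  finally show ?thesis unfolding frob_sq_def .
qed

lemma opnorm_upper:
  assumes "(\<Sum>j\<in>S. (cmod (x j))\<^sup>2) \<le> 1"
  shows "sqrt (\<Sum>i\<in>S. (cmod (\<Sum>j\<in>S. M i j * x j))\<^sup>2) \<le> opnorm S M"
proof -
  let ?A = "{sqrt (\<Sum>i\<in>S. (cmod (\<Sum>j\<in>S. M i j * y j))\<^sup>2) | y.
    (\<Sum>j\<in>S. (cmod (y j))\<^sup>2) \<le> 1}"
  have "bdd_above ?A"
  proof (rule bdd_aboveI)
    fix r assume "r \<in> ?A"
    then obtain y where "r = sqrt (\<Sum>i\<in>S. (cmod (\<Sum>j\<in>S. M i j * y j))\<^sup>2)"
      and "(\<Sum>j\<in>S. (cmod (y j))\<^sup>2) \<le> 1" by blast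
    then show "r \<le> sqrt (frob_sq S M)"
      by (simp add: norm_mult_vec_squared_le_frob_sq)
  qed
  then show ?thesis
    unfolding opnorm_def using assms by (intro cSup_upper) blast+
qed

lemma opnorm_nonneg: "0 \<le> opnorm S M"
  using opnorm_upper[where x = "\<lambda>_. 0" and S = S and M = M] by simp

lemma opnorm_bound:
  assumes "finite S"
  shows "(\<Sum>i\<in>S. (cmod (\<Sum>j\<in>S. M i j * x j))\<^sup>2) \<le> (opnorm S M)\<^sup>2 * (\<Sum>j\<in>S. (cmod (x j))\<^sup>2)"
proof (cases "(\<Sum>j\<in>S. (cmod (x j))\<^sup>2) = 0")
  case True
  then have "\<forall>j\<in>S. x j = 0"
    using assms by (simp add: sum_nonneg_eq_0_iff)
  then show ?thesis by simp
next
  case False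
  define r where "r = sqrt (\<Sum>j\<in>S. (cmod (x j))\<^sup>2)"
  have r: "r > 0"
    using False by (simp add: r_def sum_nonneg order_less_le)
  have "(\<Sum>j\<in>S. (cmod (x j / of_real r))\<^sup>2) = 1"
    using r by (simp add: r_def norm_divide power_divide sum_nonneg flip: sum_divide_distrib)
  then have "sqrt (\<Sum>i\<in>S. (cmod (\<Sum>j\<in>S. M i j * (x j / of_real r)))\<^sup>2) \<le> opnorm S M"
    by (intro opnorm_upper) simp
  also have "(\<Sum>i\<in>S. (cmod (\<Sum>j\<in>S. M i j * (x j / of_real r)))\<^sup>2)
      = (\<Sum>i\<in>S. (cmod (\<Sum>j\<in>S. M i j * x j))\<^sup>2) / r\<^sup>2"
    using r by (simp add: norm_divide power_divide sum_divide_distrib[symmetric])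
  finally have "sqrt (\<Sum>i\<in>S. (cmod (\<Sum>j\<in>S. M i j * x j))\<^sup>2) \<le> opnorm S M * r"
    using r by (simp add: real_sqrt_divide divide_le_eq)
  then have "(sqrt (\<Sum>i\<in>S. (cmod (\<Sum>j\<in>S. M i j * x j))\<^sup>2))\<^sup>2 \<le> (opnorm S M * r)\<^sup>2"
    by (rule power_mono) (simp add: sum_nonneg)
  then show ?thesis
    by (simp add: sum_nonneg power_mult_distrib r_def)
qed

lemma opnorm_bound_cnj:
  assumes "finite S"
  shows "(\<Sum>i\<in>S. (cmod (\<Sum>j\<in>S. cnj (M i j) * x j))\<^sup>2) \<le> (opnorm S M)\<^sup>2 * (\<Sum>j\<in>S. (cmod (x j))\<^sup>2)"
proof -
  have "cmod (\<Sum>j\<in>S. cnj (M i j) * x j) = cmod (\<Sum>j\<in>S. M i j * cnj (x j))" for i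
    by (metis (no_types, lifting) complex_cnj_cnj complex_cnj_mult complex_mod_cnj cnj_sum sum.cong)
  then show ?thesis
    using opnorm_bound[OF assms, of M "\<lambda>j. cnj (x j)"] by simp
qed

lemma opnorm_bound_transpose:
  assumes "finite S"
  shows "(\<Sum>i\<in>S. (cmod (\<Sum>j\<in>S. M j i * x j))\<^sup>2) \<le> (opnorm S M)\<^sup>2 * (\<Sum>j\<in>S. (cmod (x j))\<^sup>2)"
proof -
  define y where "y i = (\<Sum>j\<in>S. M j i * x j)" for i
  define T where "T = (\<Sum>i\<in>S. (cmod (y i))\<^sup>2)"
  define X where "X = (\<Sum>j\<in>S. (cmod (x j))\<^sup>2)"
  have "of_real T = (\<Sum>i\<in>S. y i * cnj (y i))"
    unfolding T_def of_real_sum complex_norm_square ..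
  also have "\<dots> = (\<Sum>j\<in>S. x j * (\<Sum>i\<in>S. M j i * cnj (y i)))"
    unfolding y_def[of i for i] sum_distrib_right sum_distrib_left
    by (subst sum.swap) (simp add: mult_ac)
  finally have "T\<^sup>2 = (cmod (\<Sum>j\<in>S. x j * (\<Sum>i\<in>S. M j i * cnj (y i))))\<^sup>2"
    by (metis norm_of_real power2_abs)
  also have "\<dots> \<le> X * (\<Sum>j\<in>S. (cmod (\<Sum>i\<in>S. M j i * cnj (y i)))\<^sup>2)"
    unfolding X_def by (rule norm_sum_mult_squared_le)
  also have "\<dots> \<le> X * ((opnorm S M)\<^sup>2 * T)"
    using opnorm_bound[OF assms, of M "\<lambda>i. cnj (y i)"]
    by (intro mult_left_mono) (simp_all add: T_def X_def sum_nonneg)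
  finally have "T * T \<le> ((opnorm S M)\<^sup>2 * X) * T"
    by (simp add: power2_eq_square mult_ac)
  moreover have "0 \<le> T"
    by (simp add: T_def sum_nonneg)
  ultimately have "T \<le> (opnorm S M)\<^sup>2 * X"
    by (cases "T = 0") (simp_all add: X_def sum_nonneg)
  then show ?thesis
    unfolding T_def X_def y_def .
qed

lemma frob_sq_mmult_le:
  assumes "\<And>x. (\<Sum>a\<in>S. (cmod (\<Sum>c\<in>S. M a c * x c))\<^sup>2) \<le> q * (\<Sum>c\<in>S. (cmod (x c))\<^sup>2)"
  shows "frob_sq S (mmult S M C) \<le> q * frob_sq S C"
proof -
  have "frob_sq S (mmult S M C) = (\<Sum>b\<in>S. \<Sum>a\<in>S. (cmod (\<Sum>c\<in>S. M a c * C c b))\<^sup>2)"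
    unfolding frob_sq_def mmult_def by (rule sum.swap)
  also have "\<dots> \<le> (\<Sum>b\<in>S. q * (\<Sum>c\<in>S. (cmod (C c b))\<^sup>2))"
    by (intro sum_mono assms)
  also have "\<dots> = q * frob_sq S C"
    unfolding frob_sq_def sum_distrib_left by (subst sum.swap) simp
  finally show ?thesis .
qed

section \<open>Log-convex sequences\<close>

lemma log_convex_geometric_lower_bound:
  fixes s :: "nat \<Rightarrow> real"
  assumes log_convex: "\<And>n. (s (Suc n))\<^sup>2 \<le> s n * s (Suc (Suc n))"
    and "0 < s 0" "0 < s 1"
  shows "(s 1 / s 0) ^ n * s 0 \<le> s n"
proof -
  define \<rho> where "\<rho> = s 1 / s 0"
  have \<rho>: "0 < \<rho>"
    using assms by (simp add: \<rho>_def)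
  \<comment> \<open>log-convexity makes the ratios \<open>s (n + 1) / s n\<close> nondecreasing\<close>
  have ratio: "0 < s n \<and> \<rho> * s n \<le> s (Suc n)" for n
  proof (induction n)
    case 0
    then show ?case using \<open>0 < s 0\<close> by (simp add: \<rho>_def)
  next
    case (Suc n)
    then have pos: "0 < s n" and step: "\<rho> * s n \<le> s (Suc n)" by auto
    then have pos': "0 < s (Suc n)" using mult_pos_pos[OF \<rho> pos] by linarith
    have "(\<rho> * s (Suc n)) * s n = (\<rho> * s n) * s (Suc n)" by simp
    also have "\<dots> \<le> s (Suc n) * s (Suc n)" using step pos' by (simp add: mult_right_mono)
    also have "\<dots> \<le> s (Suc (Suc n)) * s n" using log_convex[of n] by (simp add: power2_eq_square mult.commute)
    finally show ?case using pos pos' by (simp add: mult_le_cancel_right)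
  qed
  show ?thesis
    unfolding \<rho>_def[symmetric]
  proof (induction n)
    case (Suc n)
    then have "\<rho> ^ Suc n * s 0 \<le> \<rho> * s n" using \<rho> by (simp add: mult.assoc mult_left_mono)
    then show ?case using ratio[of n] by simp
  qed simp
qed

lemma log_convex_first_ratio_le:
  fixes s :: "nat \<Rightarrow> real"
  assumes nonneg: "\<And>n. 0 \<le> s n"
    and log_convex: "\<And>n. (s (Suc n))\<^sup>2 \<le> s n * s (Suc (Suc n))"
    and growth: "\<And>n. s n \<le> K * q ^ n"
    and "0 \<le> q"
  shows "s 1 \<le> q * s 0"
proof (rule ccontr)
  assume "\<not> s 1 \<le> q * s 0"
  then have gt: "q * s 0 < s 1" by simp
  then have "0 < s 1"
    using mult_nonneg_nonneg[OF \<open>0 \<le> q\<close> nonneg[of 0]] by linarith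
  then have "0 < s 0 * s (Suc 1)"
    using log_convex[of 0, unfolded One_nat_def[symmetric]] zero_less_power2[of "s 1"] by linarith
  then have s0: "0 < s 0"
    using nonneg[of 0] nonneg[of "Suc 1"] by (metis less_eq_real_def mult_zero_left)
  define \<rho> where "\<rho> = s 1 / s 0"
  have "q < \<rho>"
    using gt s0 by (simp add: \<rho>_def pos_less_divide_eq mult.commute)
  have geometric: "\<rho> ^ n * s 0 \<le> s n" for n
    unfolding \<rho>_def by (rule log_convex_geometric_lower_bound[OF log_convex s0 \<open>0 < s 1\<close>])
  show False
  proof (cases "q = 0")
    case True
    then show False
      using geometric[of 1] growth[of 1] mult_pos_pos[OF _ s0, of \<rho>] \<open>q < \<rho>\<close> by simp
  next
    case False
    then have q: "0 < q" using \<open>0 \<le> q\<close> by simp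
    then have "1 < \<rho> / q" using \<open>q < \<rho>\<close> by simp
    then obtain n where "K / s 0 < (\<rho> / q) ^ n" using real_arch_pow by blast
    then have "K * q ^ n < (\<rho> / q) ^ n * s 0 * q ^ n"
      using s0 q by (simp add: divide_less_eq)
    also have "\<dots> = \<rho> ^ n * s 0"
      using q by (simp add: power_divide)
    finally show False using geometric[of n] growth[of n] by simp
  qed
qed

section \<open>Polynomials in the entries of \<open>U\<^sup>\<otimes>\<^sup>k \<otimes> \<bar>U\<^sup>\<otimes>\<^sup>k\<close>\<close>

definition tens_poly :: "nat \<Rightarrow> ('n list \<Rightarrow> 'n list \<Rightarrow> complex) \<Rightarrow> complex^'n^'n \<Rightarrow> complex" where
  "tens_poly k C U = (\<Sum>a\<in>idx k. \<Sum>b\<in>idx k. C a b * tens_entry k U a b)"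

lemma continuous_on_tens_poly [continuous_intros]:
  "continuous_on S f \<Longrightarrow> continuous_on S (\<lambda>x. tens_poly k C (f x))"
  unfolding tens_poly_def by (intro continuous_intros)

lemma continuous_on_tens_poly' [continuous_intros]: "continuous_on S (tens_poly k C)"
  using continuous_on_tens_poly[OF continuous_on_id] by simp

lemma hk_gen_eq_tens_poly: "hk_gen s A U = tens_poly s (\<lambda>a b. A b a) U"
  unfolding hk_gen_def tens_poly_def by (rule sum.swap)

lemma tens_poly_add: "tens_poly k (\<lambda>a b. C a b + D a b) U = tens_poly k C U + tens_poly k D U"
  unfolding tens_poly_def by (simp add: distrib_right sum.distrib)

lemma tens_poly_cmult: "tens_poly k (\<lambda>a b. c * C a b) U = c * tens_poly k C U"
  unfolding tens_poly_def by (simp add: sum_distrib_left mult_ac)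

lemma tens_poly_sum: "tens_poly k (\<lambda>a b. \<Sum>t\<in>T. g t a b) U = (\<Sum>t\<in>T. tens_poly k (g t) U)"
proof -
  have "tens_poly k (\<lambda>a b. \<Sum>t\<in>T. g t a b) U
      = (\<Sum>a\<in>idx k. \<Sum>t\<in>T. \<Sum>b\<in>idx k. g t a b * tens_entry k U a b)"
    unfolding tens_poly_def sum_distrib_right by (rule sum.cong[OF refl]) (rule sum.swap)
  then show ?thesis
    unfolding tens_poly_def by (simp only: sum.swap[of _ "idx k" T])
qed

lemma tens_poly_Suc_idx_extend:
  assumes "a \<in> idx m" "b \<in> idx m"
  shows "tens_poly (Suc m) (\<lambda>x y. if x = idx_extend m a p \<and> y = idx_extend m b q then c else 0) U
    = c * tens_entry m U a b * (U $ p $ q * cnj (U $ p $ q))"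
  unfolding tens_poly_def using assms
  by (simp add: sum_sum_if_eq idx_extend_in_idx tens_entry_idx_extend mult.assoc)

text \<open>Multiply by \<open>1 = d\<^sup>-\<^sup>1 \<Sum>\<^sub>p\<^sub>q |U\<^sub>p\<^sub>q|\<^sup>2\<close>.\<close>
lemma tens_poly_lift_Suc:
  fixes C :: "'n::finite list \<Rightarrow> 'n list \<Rightarrow> complex"
  shows "\<exists>C'. \<forall>U. unitary U \<longrightarrow> tens_poly (Suc m) C' U = tens_poly m C U"
proof -
  define d where "d = complex_of_nat CARD('n)"
  define C' where "C' x y = (\<Sum>a\<in>idx m. \<Sum>b\<in>idx m. \<Sum>p\<in>UNIV. \<Sum>q\<in>UNIV.
    if x = idx_extend m a p \<and> y = idx_extend m b q then C a b / d else 0)" for x y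
  have "tens_poly (Suc m) C' U = tens_poly m C U" if U: "unitary U" for U
  proof -
    define w where "w = (\<Sum>p\<in>UNIV. \<Sum>q\<in>UNIV. U $ p $ q * cnj (U $ p $ q))"
    have "tens_poly (Suc m) C' U = (\<Sum>a\<in>idx m. \<Sum>b\<in>idx m. \<Sum>p\<in>UNIV. \<Sum>q\<in>UNIV.
        C a b / d * tens_entry m U a b * (U $ p $ q * cnj (U $ p $ q)))"
      unfolding C'_def tens_poly_sum by (simp add: tens_poly_Suc_idx_extend)
    also have "\<dots> = (\<Sum>a\<in>idx m. \<Sum>b\<in>idx m. C a b * tens_entry m U a b * w / d)"
      by (simp add: w_def sum_distrib_left sum_divide_distrib mult_ac)
    also have "\<dots> = tens_poly m C U * w / d"
      by (simp add: tens_poly_def sum_distrib_right sum_divide_distrib)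
    finally show ?thesis
      by (simp add: w_def d_def unitary_sum_squares[OF U])
  qed
  then show ?thesis by blast
qed

lemma tens_poly_lift:
  fixes C :: "'n::finite list \<Rightarrow> 'n list \<Rightarrow> complex"
  assumes "s \<le> k"
  shows "\<exists>C'. \<forall>U. unitary U \<longrightarrow> tens_poly k C' U = tens_poly s C U"
  using assms
proof (induction k rule: dec_induct)
  case (step n)
  then obtain C1 where "\<forall>U. unitary U \<longrightarrow> tens_poly n C1 U = tens_poly s C U" by blast
  moreover obtain C2 where "\<forall>U. unitary U \<longrightarrow> tens_poly (Suc n) C2 U = tens_poly n C1 U"
    using tens_poly_lift_Suc by blast
  ultimately show ?case by auto
qed blast

lemma Hk_eq_tens_poly:
  fixes \<Phi> :: "complex^'n::finite^'n \<Rightarrow> complex"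
  assumes "\<Phi> \<in> Hk k"
  shows "\<exists>C. \<forall>U. unitary U \<longrightarrow> \<Phi> U = tens_poly k C U"
  using assms
proof (induction rule: Hk.induct)
  case zero
  show ?case by (rule exI[of _ "\<lambda>a b. 0"]) (simp add: tens_poly_def)
next
  case (gen s c A)
  then obtain C where "\<forall>U. unitary U \<longrightarrow> tens_poly k C U = tens_poly s (\<lambda>a b. c * A b a) U"
    using tens_poly_lift by blast
  then show ?case
    by (metis hk_gen_eq_tens_poly tens_poly_cmult)
next
  case (add f g)
  then obtain C D where "\<forall>U. unitary U \<longrightarrow> f U = tens_poly k C U"
    and "\<forall>U. unitary U \<longrightarrow> g U = tens_poly k D U"
    by blast
  then show ?case
    by (intro exI[of _ "\<lambda>a b. C a b + D a b"]) (simp add: tens_poly_add)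
qed

lemma Hk_continuous: "\<Phi> \<in> Hk k \<Longrightarrow> continuous_on UNIV \<Phi>"
  by (induction rule: Hk.induct) (auto simp: hk_gen_def intro!: continuous_intros)

lemma tens_poly_mmult:
  "tens_poly k (mmult (idx k) Z C) U
    = (\<Sum>a\<in>idx k. \<Sum>b\<in>idx k. C a b * (\<Sum>c\<in>idx k. Z c a * tens_entry k U c b))"
proof -
  let ?I = "idx k :: 'n list set"
  have "tens_poly k (mmult ?I Z C) U = (\<Sum>x\<in>?I. \<Sum>b\<in>?I. \<Sum>c\<in>?I. Z x c * C c b * tens_entry k U x b)"
    unfolding tens_poly_def mmult_def by (simp add: sum_distrib_right)
  also have "\<dots> = (\<Sum>x\<in>?I. \<Sum>c\<in>?I. \<Sum>b\<in>?I. Z x c * C c b * tens_entry k U x b)"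
    by (rule sum.cong[OF refl]) (rule sum.swap)
  also have "\<dots> = (\<Sum>c\<in>?I. \<Sum>x\<in>?I. \<Sum>b\<in>?I. Z x c * C c b * tens_entry k U x b)"
    by (rule sum.swap)
  also have "\<dots> = (\<Sum>c\<in>?I. \<Sum>b\<in>?I. \<Sum>x\<in>?I. Z x c * C c b * tens_entry k U x b)"
    by (rule sum.cong[OF refl]) (rule sum.swap)
  also have "\<dots> = (\<Sum>a\<in>?I. \<Sum>b\<in>?I. C a b * (\<Sum>c\<in>?I. Z c a * tens_entry k U c b))"
    by (simp add: sum_distrib_left mult_ac)
  finally show ?thesis .
qed

lemma tens_poly_mmult_rows:
  "tens_poly k (mmult (idx k) Z C) U
    = (\<Sum>a\<in>idx k. \<Sum>c\<in>idx k. Z a c * (\<Sum>b\<in>idx k. C c b * tens_entry k U a b))"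
proof -
  let ?I = "idx k :: 'n list set"
  have "tens_poly k (mmult ?I Z C) U = (\<Sum>a\<in>?I. \<Sum>b\<in>?I. \<Sum>c\<in>?I. Z a c * C c b * tens_entry k U a b)"
    unfolding tens_poly_def mmult_def by (simp add: sum_distrib_right)
  also have "\<dots> = (\<Sum>a\<in>?I. \<Sum>c\<in>?I. \<Sum>b\<in>?I. Z a c * C c b * tens_entry k U a b)"
    by (rule sum.cong[OF refl]) (rule sum.swap)
  finally show ?thesis
    by (simp add: sum_distrib_left mult_ac)
qed

lemma tens_poly_cadj_mult:
  "tens_poly k C (cadj W ** U) = tens_poly k (mmult (idx k) (\<lambda>a c. cnj (tens_entry k W a c)) C) U"
  unfolding tens_poly_mmult by (simp only: tens_poly_def tens_entry_mult tens_entry_cadj)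

lemma tens_poly_mult_left:
  "tens_poly k D (W ** U) = tens_poly k (mmult (idx k) (\<lambda>a c. tens_entry k W c a) D) U"
  unfolding tens_poly_mmult by (simp only: tens_poly_def tens_entry_mult)

lemma tens_poly_mmult_diff:
  "tens_poly k (mmult (idx k) (\<lambda>a c. Z a c - Z' a c) C)
    = (\<lambda>U. tens_poly k (mmult (idx k) Z C) U - tens_poly k (mmult (idx k) Z' C) U)"
  by (rule ext) (simp add: tens_poly_mmult left_diff_distrib right_diff_distrib sum_subtractf)

lemma norm_tens_poly_squared_le:
  fixes X :: "'n::finite list \<Rightarrow> 'n list \<Rightarrow> complex"
  assumes "unitary U"
  shows "(cmod (tens_poly k X U))\<^sup>2 \<le> real (card (idx k \<times> idx k :: ('n list \<times> 'n list) set)) * frob_sq (idx k) X"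
proof -
  let ?P = "idx k \<times> idx k :: ('n list \<times> 'n list) set"
  have "(cmod (tens_poly k X U))\<^sup>2
      = (cmod (\<Sum>p\<in>?P. X (fst p) (snd p) * tens_entry k U (fst p) (snd p)))\<^sup>2"
    by (simp add: tens_poly_def sum.cartesian_product case_prod_unfold)
  also have "\<dots> \<le> (\<Sum>p\<in>?P. (cmod (X (fst p) (snd p)))\<^sup>2) * (\<Sum>p\<in>?P. (cmod (tens_entry k U (fst p) (snd p)))\<^sup>2)"
    by (rule norm_sum_mult_squared_le)
  also have "\<dots> \<le> frob_sq (idx k) X * real (card ?P)"
  proof -
    have "(\<Sum>p\<in>?P. (cmod (X (fst p) (snd p)))\<^sup>2) = frob_sq (idx k) X"
      by (simp add: frob_sq_def sum.cartesian_product case_prod_unfold)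
    moreover have "(\<Sum>p\<in>?P. (cmod (tens_entry k U (fst p) (snd p)))\<^sup>2) \<le> real (card ?P)"
      using sum_bounded_above[of ?P "\<lambda>p. (cmod (tens_entry k U (fst p) (snd p)))\<^sup>2" 1]
      by (simp add: power_le_one norm_tens_entry_le[OF assms])
    ultimately show ?thesis
      by (simp add: mult_left_mono frob_sq_nonneg)
  qed
  finally show ?thesis by (simp add: mult.commute)
qed

section \<open>Square-integrable functions\<close>

lemma Cauchy_Schwarz_integral:
  fixes f g :: "'a \<Rightarrow> real"
  assumes [measurable]: "f \<in> borel_measurable M" "g \<in> borel_measurable M"
    and nonneg: "\<And>x. 0 \<le> f x" "\<And>x. 0 \<le> g x"
    and int: "integrable M (\<lambda>x. (f x)\<^sup>2)" "integrable M (\<lambda>x. (g x)\<^sup>2)" "integrable M (\<lambda>x. f x * g x)"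
  shows "(\<integral>x. f x * g x \<partial>M) \<le> sqrt (\<integral>x. (f x)\<^sup>2 \<partial>M) * sqrt (\<integral>x. (g x)\<^sup>2 \<partial>M)"
proof -
  have nn: "(\<integral>\<^sup>+x. ennreal (h x) \<partial>M) = ennreal (\<integral>x. h x \<partial>M)"
    if "integrable M h" "\<And>x. 0 \<le> h x" for h :: "'a \<Rightarrow> real"
    using that by (intro nn_integral_eq_integral) auto
  have fg: "(\<integral>\<^sup>+x. ennreal (f x) * ennreal (g x) \<partial>M) = ennreal (\<integral>x. f x * g x \<partial>M)"
    using nn[OF int(3) mult_nonneg_nonneg[OF nonneg]] nonneg by (simp add: ennreal_mult)
  have ff: "(\<integral>\<^sup>+x. ennreal (f x) ^ 2 \<partial>M) = ennreal (\<integral>x. (f x)\<^sup>2 \<partial>M)"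
    using nn[OF int(1) zero_le_power2] nonneg by (simp add: ennreal_power)
  have gg: "(\<integral>\<^sup>+x. ennreal (g x) ^ 2 \<partial>M) = ennreal (\<integral>x. (g x)\<^sup>2 \<partial>M)"
    using nn[OF int(2) zero_le_power2] nonneg by (simp add: ennreal_power)
  have "ennreal (\<integral>x. f x * g x \<partial>M) ^ 2 \<le> ennreal (\<integral>x. (f x)\<^sup>2 \<partial>M) * ennreal (\<integral>x. (g x)\<^sup>2 \<partial>M)"
    using Cauchy_Schwarz_nn_integral[of "\<lambda>x. ennreal (f x)" M "\<lambda>x. ennreal (g x)"]
    unfolding fg ff gg by simp
  moreover have "0 \<le> (\<integral>x. f x * g x \<partial>M)" "0 \<le> (\<integral>x. (f x)\<^sup>2 \<partial>M)" "0 \<le> (\<integral>x. (g x)\<^sup>2 \<partial>M)"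
    using nonneg by (simp_all add: integral_nonneg)
  ultimately have "(\<integral>x. f x * g x \<partial>M)\<^sup>2 \<le> (\<integral>x. (f x)\<^sup>2 \<partial>M) * (\<integral>x. (g x)\<^sup>2 \<partial>M)"
    by (simp add: ennreal_power ennreal_mult[symmetric])
  then have "sqrt ((\<integral>x. f x * g x \<partial>M)\<^sup>2) \<le> sqrt ((\<integral>x. (f x)\<^sup>2 \<partial>M) * (\<integral>x. (g x)\<^sup>2 \<partial>M))"
    by (rule real_sqrt_le_mono)
  then show ?thesis
    by (simp add: real_sqrt_mult)
qed

lemma (in finite_measure) norm_set_integral_le_sqrt:
  fixes f :: "'a \<Rightarrow> 'b::{banach, second_countable_topology}"
  assumes B: "B \<in> sets M" and [measurable]: "f \<in> borel_measurable M"
    and square_integrable: "integrable M (\<lambda>x. (norm (f x))\<^sup>2)"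
  shows "norm (LINT x:B|M. f x) \<le> sqrt (measure M B) * sqrt (\<integral>x. (norm (f x))\<^sup>2 \<partial>M)"
proof -
  have indicator_squared: "(\<lambda>x. (indicator B x :: real)\<^sup>2) = indicator B"
    by (auto simp: indicator_def)
  have "integrable M (\<lambda>x. norm (f x))"
    by (rule square_integrable_imp_integrable) (simp_all add: square_integrable)
  then have "integrable M (\<lambda>x. indicator B x * norm (f x))"
    using integrable_mult_indicator[OF B] by fastforce
  have "norm (LINT x:B|M. f x) \<le> (\<integral>x. norm (indicator B x *\<^sub>R f x) \<partial>M)"
    unfolding set_lebesgue_integral_def by (rule integral_norm_bound)
  also have "\<dots> = (\<integral>x. indicator B x * norm (f x) \<partial>M)"
    by (simp add: indicator_def)
  also have "\<dots> \<le> sqrt (\<integral>x. (indicator B x)\<^sup>2 \<partial>M) * sqrt (\<integral>x. (norm (f x))\<^sup>2 \<partial>M)"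
    using \<open>integrable M (\<lambda>x. indicator B x * norm (f x))\<close>
    by (intro Cauchy_Schwarz_integral)
      (simp_all add: indicator_squared B square_integrable borel_measurable_indicator
        integrable_real_indicator emeasure_finite[unfolded less_top])
  also have "(\<integral>x. (indicator B x :: real)\<^sup>2 \<partial>M) = measure M B"
    using B by (simp add: indicator_squared)
  finally show ?thesis .
qed

definition L2_inner :: "'a measure \<Rightarrow> ('a \<Rightarrow> complex) \<Rightarrow> ('a \<Rightarrow> complex) \<Rightarrow> complex" where
  "L2_inner M f g = (\<integral>x. cnj (f x) * g x \<partial>M)"

lemma cnj_L2_inner: "cnj (L2_inner M f g) = L2_inner M g f"
proof -
  have "cnj (L2_inner M f g) = (\<integral>x. cnj (cnj (f x) * g x) \<partial>M)"
    unfolding L2_inner_def by (rule Bochner_Integration.integral_cnj[symmetric])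
  also have "\<dots> = L2_inner M g f"
    unfolding L2_inner_def by (simp add: mult.commute)
  finally show ?thesis .
qed

lemma L2_inner_self: "L2_inner M f f = of_real ((L2norm M f)\<^sup>2)"
proof -
  have "L2_inner M f f = (\<integral>x. of_real ((cmod (f x))\<^sup>2) \<partial>M)"
    unfolding L2_inner_def complex_norm_square by (simp only: mult.commute)
  also have "\<dots> = of_real ((L2norm M f)\<^sup>2)"
    by (simp only: integral_complex_of_real) (simp add: L2norm_def integral_nonneg)
  finally show ?thesis .
qed

section \<open>Probability measures on the unitary group\<close>

locale unitary_prob_space = prob_space M for M :: "(complex^'n::finite^'n) measure" +
  assumes sets_eq_borel: "sets M = sets borel"
    and AE_unitary: "AE U in M. unitary U"
begin

lemma measurable_continuous: "continuous_on UNIV f \<Longrightarrow> f \<in> borel_measurable M"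
  by (subst measurable_cong_sets[OF sets_eq_borel refl]) (rule borel_measurable_continuous_onI)

lemma integrable_continuous:
  fixes f :: "complex^'n^'n \<Rightarrow> 'b::{banach, second_countable_topology}"
  assumes "continuous_on UNIV f"
  shows "integrable M f"
proof -
  have "compact (f ` {U. unitary U})"
    using compact_continuous_image[OF continuous_on_subset[OF assms] compact_unitary] by simp
  then have "bounded (f ` {U. unitary U})"
    by (rule compact_imp_bounded)
  then obtain B where B: "\<And>U. unitary U \<Longrightarrow> norm (f U) \<le> B"
    unfolding bounded_iff by blast
  have "AE U in M. norm (f U) \<le> B"
    using AE_unitary by eventually_elim (rule B)
  then show ?thesis
    by (rule integrable_const_bound) (rule measurable_continuous[OF assms])
qed

lemma integral_sum_continuous:
  fixes f :: "'i \<Rightarrow> complex^'n^'n \<Rightarrow> 'b::{banach, second_countable_topology}"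
  assumes "\<And>i. i \<in> I \<Longrightarrow> continuous_on UNIV (f i)"
  shows "(\<integral>U. (\<Sum>i\<in>I. f i U) \<partial>M) = (\<Sum>i\<in>I. \<integral>U. f i U \<partial>M)"
  by (intro Bochner_Integration.integral_sum integrable_continuous assms)

lemma integral_double_sum:
  fixes F :: "'a \<Rightarrow> 'b \<Rightarrow> complex^'n^'n \<Rightarrow> complex"
  assumes "\<And>a c. continuous_on UNIV (F a c)"
  shows "(\<integral>U. (\<Sum>a\<in>A. \<Sum>c\<in>B. K a c * F a c U) \<partial>M) = (\<Sum>a\<in>A. \<Sum>c\<in>B. K a c * (\<integral>U. F a c U \<partial>M))"
proof -
  have "(\<integral>U. (\<Sum>a\<in>A. \<Sum>c\<in>B. K a c * F a c U) \<partial>M) = (\<Sum>a\<in>A. \<integral>U. (\<Sum>c\<in>B. K a c * F a c U) \<partial>M)"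
    by (rule integral_sum_continuous) (intro continuous_intros assms)
  also have "\<dots> = (\<Sum>a\<in>A. \<Sum>c\<in>B. \<integral>U. K a c * F a c U \<partial>M)"
    by (intro sum.cong refl integral_sum_continuous continuous_intros assms)
  finally show ?thesis by simp
qed

lemma integral_cong_unitary:
  fixes f g :: "complex^'n^'n \<Rightarrow> 'b::{banach, second_countable_topology}"
  assumes "\<And>U. unitary U \<Longrightarrow> f U = g U" "continuous_on UNIV f" "continuous_on UNIV g"
  shows "(\<integral>U. f U \<partial>M) = (\<integral>U. g U \<partial>M)"
proof (rule integral_cong_AE)
  show "AE U in M. f U = g U"
    using AE_unitary by eventually_elim (rule assms(1))
qed (simp_all add: measurable_continuous assms(2,3))

lemma integral_tens_poly: "(\<integral>U. tens_poly k C U \<partial>M) = (\<Sum>a\<in>idx k. \<Sum>b\<in>idx k. C a b * Tmom M k a b)"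
  unfolding tens_poly_def Tmom_def by (rule integral_double_sum) (intro continuous_intros)

lemma Tnu_tens_poly:
  assumes U: "unitary U" and \<Phi>: "\<And>V. unitary V \<Longrightarrow> \<Phi> V = tens_poly k C V"
    and "continuous_on UNIV \<Phi>"
  shows "Tnu M \<Phi> U = tens_poly k (mmult (idx k) (\<lambda>a c. cnj (Tmom M k a c)) C) U"
proof -
  define R where "R a c = (\<Sum>b\<in>idx k. C c b * tens_entry k U a b)" for a c
  have "Tnu M \<Phi> U = (\<integral>W. tens_poly k C (cadj W ** U) \<partial>M)"
    unfolding Tnu_def
    by (rule integral_cong_unitary)
      (auto simp: \<Phi> U unitary_cadj unitary_mult
        intro!: continuous_intros continuous_on_compose2[OF \<open>continuous_on UNIV \<Phi>\<close> _ subset_UNIV])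
  also have "\<dots> = (\<integral>W. (\<Sum>a\<in>idx k. \<Sum>c\<in>idx k. R a c * cnj (tens_entry k W a c)) \<partial>M)"
    by (simp add: tens_poly_cadj_mult tens_poly_mmult_rows R_def mult.commute)
  also have "\<dots> = (\<Sum>a\<in>idx k. \<Sum>c\<in>idx k. R a c * cnj (Tmom M k a c))"
    unfolding Tmom_def by (subst integral_double_sum) (auto intro!: continuous_intros)
  also have "\<dots> = tens_poly k (mmult (idx k) (\<lambda>a c. cnj (Tmom M k a c)) C) U"
    by (simp add: tens_poly_mmult_rows R_def mult.commute)
  finally show ?thesis .
qed

lemma norm_L2_inner_le:
  assumes "continuous_on UNIV f" "continuous_on UNIV g"
  shows "cmod (L2_inner M f g) \<le> L2norm M f * L2norm M g"
proof -
  have "cmod (L2_inner M f g) \<le> (\<integral>x. cmod (f x) * cmod (g x) \<partial>M)"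
    unfolding L2_inner_def using integral_norm_bound[of M "\<lambda>x. cnj (f x) * g x"]
    by (simp add: norm_mult)
  also have "\<dots> \<le> L2norm M f * L2norm M g"
    unfolding L2norm_def
    by (rule Cauchy_Schwarz_integral)
      (auto intro!: measurable_continuous integrable_continuous continuous_intros assms)
  finally show ?thesis .
qed

lemma L2_inner_diff_left:
  assumes "continuous_on UNIV f" "continuous_on UNIV f'" "continuous_on UNIV g"
  shows "L2_inner M (\<lambda>x. f x - f' x) g = L2_inner M f g - L2_inner M f' g"
  unfolding L2_inner_def complex_cnj_diff left_diff_distrib
  by (rule Bochner_Integration.integral_diff) (auto intro!: integrable_continuous continuous_intros assms)

lemma L2_inner_diff_right:
  assumes "continuous_on UNIV f" "continuous_on UNIV g" "continuous_on UNIV g'"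
  shows "L2_inner M f (\<lambda>x. g x - g' x) = L2_inner M f g - L2_inner M f g'"
  unfolding L2_inner_def right_diff_distrib
  by (rule Bochner_Integration.integral_diff) (auto intro!: integrable_continuous continuous_intros assms)

lemma L2_inner_mmult_left:
  assumes "continuous_on UNIV g"
  shows "L2_inner M (tens_poly k (mmult (idx k) Z C)) g
    = (\<Sum>a\<in>idx k. \<Sum>c\<in>idx k. cnj (Z a c) * L2_inner M (\<lambda>U. \<Sum>b\<in>idx k. C c b * tens_entry k U a b) g)"
  unfolding L2_inner_def tens_poly_mmult_rows cnj_sum complex_cnj_mult sum_distrib_right mult.assoc
  by (rule integral_double_sum) (intro continuous_intros assms)

lemma L2_inner_mmult_right:
  assumes "continuous_on UNIV f"
  shows "L2_inner M f (tens_poly k (mmult (idx k) Z D))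
    = (\<Sum>a\<in>idx k. \<Sum>c\<in>idx k. Z a c * L2_inner M f (\<lambda>U. \<Sum>b\<in>idx k. D c b * tens_entry k U a b))"
proof -
  have "cnj (f U) * tens_poly k (mmult (idx k) Z D) U
      = (\<Sum>a\<in>idx k. \<Sum>c\<in>idx k. Z a c * (cnj (f U) * (\<Sum>b\<in>idx k. D c b * tens_entry k U a b)))" for U
    by (simp add: tens_poly_mmult_rows sum_distrib_left mult_ac)
  then show ?thesis
    unfolding L2_inner_def by (simp only:) (rule integral_double_sum, intro continuous_intros assms)
qed

lemma L2norm_adjoint_iterates_log_convex:
  assumes adjoint: "\<And>n X Z. L2_inner M (tens_poly k (mmult (idx k) (A n) X)) (tens_poly k Z)
      = L2_inner M (tens_poly k X) (tens_poly k (mmult (idx k) (A (Suc n)) Z))"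
    and iterate: "\<And>n. u (Suc n) = mmult (idx k) (A n) (u n)"
  shows "((L2norm M (tens_poly k (u (Suc n))))\<^sup>2)\<^sup>2
    \<le> (L2norm M (tens_poly k (u n)))\<^sup>2 * (L2norm M (tens_poly k (u (Suc (Suc n)))))\<^sup>2"
proof -
  have "of_real ((L2norm M (tens_poly k (u (Suc n))))\<^sup>2)
      = L2_inner M (tens_poly k (mmult (idx k) (A n) (u n))) (tens_poly k (u (Suc n)))"
    by (simp only: L2_inner_self iterate)
  also have "\<dots> = L2_inner M (tens_poly k (u n)) (tens_poly k (u (Suc (Suc n))))"
    by (simp only: adjoint iterate)
  finally have "(L2norm M (tens_poly k (u (Suc n))))\<^sup>2
      = cmod (L2_inner M (tens_poly k (u n)) (tens_poly k (u (Suc (Suc n)))))"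
    by (metis abs_of_nonneg norm_of_real zero_le_power2)
  also have "\<dots> \<le> L2norm M (tens_poly k (u n)) * L2norm M (tens_poly k (u (Suc (Suc n))))"
    by (rule norm_L2_inner_le) (intro continuous_intros)+
  finally have "((L2norm M (tens_poly k (u (Suc n))))\<^sup>2)\<^sup>2
      \<le> (L2norm M (tens_poly k (u n)) * L2norm M (tens_poly k (u (Suc (Suc n)))))\<^sup>2"
    by (rule power_mono) simp
  then show ?thesis
    by (simp add: power_mult_distrib)
qed

lemma L2norm_tens_poly_squared_le:
  "(L2norm M (tens_poly k X))\<^sup>2 \<le> real (card (idx k \<times> idx k :: ('n list \<times> 'n list) set)) * frob_sq (idx k) X"
proof -
  have "AE U in M. (cmod (tens_poly k X U))\<^sup>2 \<le> real (card (idx k \<times> idx k :: ('n list \<times> 'n list) set)) * frob_sq (idx k) X"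
    using AE_unitary by eventually_elim (rule norm_tens_poly_squared_le)
  then have "(\<integral>U. (cmod (tens_poly k X U))\<^sup>2 \<partial>M) \<le> real (card (idx k \<times> idx k :: ('n list \<times> 'n list) set)) * frob_sq (idx k) X"
    by (intro integral_le_const integrable_continuous continuous_intros)
  then show ?thesis
    by (simp add: L2norm_def integral_nonneg)
qed

lemma L2norm_cong_unitary:
  assumes "\<And>U. unitary U \<Longrightarrow> f U = g U" "continuous_on UNIV f" "continuous_on UNIV g"
  shows "L2norm M f = L2norm M g"
  unfolding L2norm_def using assms
  by (intro arg_cong[where f = sqrt] integral_cong_unitary) (auto intro!: continuous_intros)

lemma norm_set_integral_diff_measure_le:
  fixes E :: "complex^'n^'n \<Rightarrow> complex"
  assumes B: "B \<in> sets M" and F: "\<And>U. U \<in> B \<Longrightarrow> F U = c + E U" and E: "continuous_on UNIV E"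
  shows "cmod ((LINT U:B|M. F U) - measure M B *\<^sub>R c) \<le> sqrt (measure M B) * L2norm M E"
proof -
  have set_integrable: "set_integrable M B f" if "continuous_on UNIV f" for f :: "_ \<Rightarrow> complex"
    unfolding set_integrable_def by (rule integrable_mult_indicator[OF B integrable_continuous[OF that]])
  have "(LINT U:B|M. F U) = (LINT U:B|M. c + E U)"
    using F by (intro set_lebesgue_integral_cong[OF B]) simp
  also have "\<dots> = (LINT U:B|M. c) + (LINT U:B|M. E U)"
    by (rule set_integral_add(2)) (auto intro!: set_integrable continuous_intros E)
  also have "(LINT U:B|M. c) = measure M B *\<^sub>R c"
    by (subst set_integral_const) (simp_all add: B emeasure_finite)
  finally have "(LINT U:B|M. F U) - measure M B *\<^sub>R c = (LINT U:B|M. E U)"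
    by simp
  then show ?thesis
    unfolding L2norm_def
    by (auto intro!: norm_set_integral_le_sqrt[OF B] measurable_continuous integrable_continuous
        continuous_intros E)
qed

end

section \<open>The Haar measure\<close>

locale haar_measure = unitary_prob_space \<mu> for \<mu> :: "(complex^'n::finite^'n) measure" +
  assumes left_invariant: "unitary W \<Longrightarrow> distr \<mu> borel (\<lambda>U. W ** U) = \<mu>"
    and right_invariant: "unitary W \<Longrightarrow> distr \<mu> borel (\<lambda>U. U ** W) = \<mu>"

lemma haar_measureI: "haar \<mu> \<Longrightarrow> haar_measure \<mu>"
  by (simp add: haar_def haar_measure_def haar_measure_axioms_def unitary_prob_space_def
      unitary_prob_space_axioms_def)

context haar_measure
begin

lemma integral_left_translate:
  fixes f :: "complex^'n^'n \<Rightarrow> complex"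
  assumes "unitary W" "continuous_on UNIV f"
  shows "(\<integral>U. f (W ** U) \<partial>\<mu>) = (\<integral>U. f U \<partial>\<mu>)"
proof -
  have "(\<integral>U. f (W ** U) \<partial>\<mu>) = (\<integral>U. f U \<partial>distr \<mu> borel (\<lambda>U. W ** U))"
    by (rule integral_distr[symmetric])
      (auto intro!: measurable_continuous borel_measurable_continuous_onI continuous_intros assms)
  then show ?thesis
    by (simp add: left_invariant[OF assms(1)])
qed

lemma integral_right_translate:
  fixes f :: "complex^'n^'n \<Rightarrow> complex"
  assumes "unitary W" "continuous_on UNIV f"
  shows "(\<integral>U. f (U ** W) \<partial>\<mu>) = (\<integral>U. f U \<partial>\<mu>)"
proof -
  have "(\<integral>U. f (U ** W) \<partial>\<mu>) = (\<integral>U. f U \<partial>distr \<mu> borel (\<lambda>U. U ** W))"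
    by (rule integral_distr[symmetric])
      (auto intro!: measurable_continuous borel_measurable_continuous_onI continuous_intros assms)
  then show ?thesis
    by (simp add: right_invariant[OF assms(1)])
qed

lemma moment_right_invariant:
  assumes "unitary U"
  shows "(\<Sum>c\<in>idx k. Tmom \<mu> k a c * tens_entry k U c b) = Tmom \<mu> k a b"
proof -
  have "(\<integral>W. tens_entry k (W ** U) a b \<partial>\<mu>) = (\<Sum>c\<in>idx k. \<integral>W. tens_entry k W a c * tens_entry k U c b \<partial>\<mu>)"
    unfolding tens_entry_mult by (rule integral_sum_continuous) (intro continuous_intros)
  moreover have "(\<integral>W. tens_entry k (W ** U) a b \<partial>\<mu>) = Tmom \<mu> k a b"
    unfolding Tmom_def by (rule integral_right_translate[OF assms]) (intro continuous_intros)
  ultimately show ?thesis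
    by (simp add: Tmom_def)
qed

text \<open>Right invariance makes the moment matrix \<open>P\<close> an idempotent with \<open>P P\<^sup>* = P\<close>,
  hence hermitian.\<close>
lemma moment_hermitian: "cnj (Tmom \<mu> k b a) = Tmom \<mu> k a b"
proof -
  have idem: "(\<Sum>c\<in>idx k. Tmom \<mu> k a c * cnj (Tmom \<mu> k b c)) = Tmom \<mu> k a b" for a b
  proof -
    have "(\<Sum>c\<in>idx k. Tmom \<mu> k a c * cnj (Tmom \<mu> k b c))
        = (\<integral>W. (\<Sum>c\<in>idx k. Tmom \<mu> k a c * tens_entry k (cadj W) c b) \<partial>\<mu>)"
      unfolding tens_entry_cadj Tmom_def[of \<mu> k b]
      by (subst integral_sum_continuous) (auto intro!: continuous_intros)
    also have "\<dots> = (\<integral>W. Tmom \<mu> k a b \<partial>\<mu>)"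
    proof (rule integral_cong_AE)
      show "AE W in \<mu>. (\<Sum>c\<in>idx k. Tmom \<mu> k a c * tens_entry k (cadj W) c b) = Tmom \<mu> k a b"
        using AE_unitary by eventually_elim (rule moment_right_invariant[OF unitary_cadj])
    qed (auto intro!: measurable_continuous continuous_intros)
    finally show ?thesis
      by (simp add: prob_space)
  qed
  have "cnj (Tmom \<mu> k b a) = cnj (\<Sum>c\<in>idx k. Tmom \<mu> k b c * cnj (Tmom \<mu> k a c))"
    by (simp only: idem)
  also have "\<dots> = (\<Sum>c\<in>idx k. Tmom \<mu> k a c * cnj (Tmom \<mu> k b c))"
    by (simp add: cnj_sum mult.commute)
  also have "\<dots> = Tmom \<mu> k a b"
    by (rule idem)
  finally show ?thesis .
qed

lemma tens_poly_mmult_moment: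
  assumes "unitary U"
  shows "tens_poly k (mmult (idx k) (\<lambda>a c. cnj (Tmom \<mu> k a c)) C) U = (\<integral>V. tens_poly k C V \<partial>\<mu>)"
  by (simp add: tens_poly_mmult moment_hermitian moment_right_invariant[OF assms] integral_tens_poly)

lemma L2_inner_left_translate:
  assumes W: "unitary W" and f: "continuous_on UNIV f" and g: "continuous_on UNIV g"
  shows "L2_inner \<mu> (\<lambda>U. f (cadj W ** U)) g = L2_inner \<mu> f (\<lambda>U. g (W ** U))"
proof -
  have "L2_inner \<mu> (\<lambda>U. f (cadj W ** U)) g = (\<integral>U. cnj (f (cadj W ** (W ** U))) * g (W ** U) \<partial>\<mu>)"
    unfolding L2_inner_def
    by (rule integral_left_translate[OF W, symmetric])
      (intro continuous_intros continuous_on_compose2[OF f _ subset_UNIV] g)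
  then show ?thesis
    by (simp add: L2_inner_def unitary_cadj_mult_cancel[OF W])
qed

text \<open>Average \<open>L2_inner_left_translate\<close> over \<open>W \<sim> \<rho>\<close>; both sides are linear in the entries of
  \<open>W\<^sup>\<otimes>\<^sup>k \<otimes> \<bar>W\<^sup>\<otimes>\<^sup>k\<close>.\<close>
lemma moment_adjoint:
  assumes "unitary_prob_space \<rho>"
  shows "L2_inner \<mu> (tens_poly k (mmult (idx k) (\<lambda>a c. cnj (Tmom \<rho> k a c)) C)) (tens_poly k D)
    = L2_inner \<mu> (tens_poly k C) (tens_poly k (mmult (idx k) (\<lambda>a c. Tmom \<rho> k c a) D))"
proof -
  interpret \<rho>: unitary_prob_space \<rho> by (rule assms)
  let ?I = "idx k"
  define Zf where "Zf a c = L2_inner \<mu> (\<lambda>U. \<Sum>b\<in>?I. C c b * tens_entry k U a b) (tens_poly k D)" for a c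
  define Zg where "Zg a c = L2_inner \<mu> (tens_poly k C) (\<lambda>U. \<Sum>b\<in>?I. D c b * tens_entry k U a b)" for a c
  have left: "L2_inner \<mu> (tens_poly k (mmult ?I Z C)) (tens_poly k D) = (\<Sum>a\<in>?I. \<Sum>c\<in>?I. cnj (Z a c) * Zf a c)" for Z
    unfolding Zf_def by (rule L2_inner_mmult_left) (intro continuous_intros)
  have right: "L2_inner \<mu> (tens_poly k C) (tens_poly k (mmult ?I Z D)) = (\<Sum>a\<in>?I. \<Sum>c\<in>?I. Z a c * Zg a c)" for Z
    unfolding Zg_def by (rule L2_inner_mmult_right) (intro continuous_intros)
  have translate: "(\<Sum>a\<in>?I. \<Sum>c\<in>?I. Zf a c * tens_entry k W a c) = (\<Sum>a\<in>?I. \<Sum>c\<in>?I. Zg a c * tens_entry k W c a)"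
    if "unitary W" for W
  proof -
    have "L2_inner \<mu> (\<lambda>U. tens_poly k C (cadj W ** U)) (tens_poly k D)
        = L2_inner \<mu> (tens_poly k C) (\<lambda>U. tens_poly k D (W ** U))"
      by (rule L2_inner_left_translate[OF that]) (intro continuous_intros)+
    then show ?thesis
      unfolding tens_poly_cadj_mult tens_poly_mult_left left right by (simp add: tens_entry_cadj mult.commute)
  qed
  have "(\<Sum>a\<in>?I. \<Sum>c\<in>?I. Zf a c * Tmom \<rho> k a c) = (\<integral>W. (\<Sum>a\<in>?I. \<Sum>c\<in>?I. Zf a c * tens_entry k W a c) \<partial>\<rho>)"
    unfolding Tmom_def by (rule \<rho>.integral_double_sum[symmetric]) (intro continuous_intros)
  also have "\<dots> = (\<integral>W. (\<Sum>a\<in>?I. \<Sum>c\<in>?I. Zg a c * tens_entry k W c a) \<partial>\<rho>)"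
  proof (rule integral_cong_AE)
    show "AE W in \<rho>. (\<Sum>a\<in>?I. \<Sum>c\<in>?I. Zf a c * tens_entry k W a c) = (\<Sum>a\<in>?I. \<Sum>c\<in>?I. Zg a c * tens_entry k W c a)"
      using \<rho>.AE_unitary by eventually_elim (rule translate)
  qed (auto intro!: \<rho>.measurable_continuous continuous_intros)
  also have "\<dots> = (\<Sum>a\<in>?I. \<Sum>c\<in>?I. Zg a c * Tmom \<rho> k c a)"
    unfolding Tmom_def by (rule \<rho>.integral_double_sum) (intro continuous_intros)
  finally show ?thesis
    unfolding left right by (simp add: mult.commute)
qed

lemma moment_diff_adjoint:
  assumes "unitary_prob_space \<nu>"
  shows "L2_inner \<mu> (tens_poly k (mmult (idx k) (\<lambda>a c. cnj (Tmom \<nu> k a c - Tmom \<mu> k a c)) C)) (tens_poly k D)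
    = L2_inner \<mu> (tens_poly k C) (tens_poly k (mmult (idx k) (\<lambda>a c. Tmom \<nu> k c a - Tmom \<mu> k c a) D))"
  by (simp add: tens_poly_mmult_diff L2_inner_diff_left L2_inner_diff_right continuous_intros
      moment_adjoint[OF assms] moment_adjoint[OF unitary_prob_space_axioms])

lemma moment_diff_adjoint_transpose:
  assumes "unitary_prob_space \<nu>"
  shows "L2_inner \<mu> (tens_poly k (mmult (idx k) (\<lambda>a c. Tmom \<nu> k c a - Tmom \<mu> k c a) C)) (tens_poly k D)
    = L2_inner \<mu> (tens_poly k C) (tens_poly k (mmult (idx k) (\<lambda>a c. cnj (Tmom \<nu> k a c - Tmom \<mu> k a c)) D))"
proof -
  have "L2_inner \<mu> (tens_poly k (mmult (idx k) (\<lambda>a c. Tmom \<nu> k c a - Tmom \<mu> k c a) C)) (tens_poly k D)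
      = cnj (L2_inner \<mu> (tens_poly k D) (tens_poly k (mmult (idx k) (\<lambda>a c. Tmom \<nu> k c a - Tmom \<mu> k c a) C)))"
    by (simp only: cnj_L2_inner)
  also have "\<dots> = cnj (L2_inner \<mu> (tens_poly k (mmult (idx k) (\<lambda>a c. cnj (Tmom \<nu> k a c - Tmom \<mu> k a c)) D)) (tens_poly k C))"
    by (simp only: moment_diff_adjoint[OF assms])
  also have "\<dots> = L2_inner \<mu> (tens_poly k C) (tens_poly k (mmult (idx k) (\<lambda>a c. cnj (Tmom \<nu> k a c - Tmom \<mu> k a c)) D))"
    by (simp only: cnj_L2_inner)
  finally show ?thesis .
qed

text \<open>\<open>C \<mapsto> tens_poly k C\<close> is not an isometry from the Frobenius norm to \<open>L\<^sup>2(\<mu>)\<close>, so the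
  operator norm of \<open>\<Delta>\<close> does not transfer directly. Instead, applying \<open>\<Delta>\<close> and its adjoint
  alternately gives a log-convex sequence of squared \<open>L\<^sup>2\<close> norms that grows at most like
  \<open>\<parallel>\<Delta>\<parallel>\<^sup>2\<^sup>n\<close>.\<close>
lemma L2norm_moment_diff_le:
  assumes \<nu>: "unitary_prob_space \<nu>"
  shows "L2norm \<mu> (tens_poly k (mmult (idx k) (\<lambda>a c. cnj (Tmom \<nu> k a c - Tmom \<mu> k a c)) C))
    \<le> opnorm (idx k) (\<lambda>a c. Tmom \<nu> k a c - Tmom \<mu> k a c) * L2norm \<mu> (tens_poly k C)"
proof -
  let ?I = "idx k :: 'n list set" and ?\<Delta> = "\<lambda>a c. Tmom \<nu> k a c - Tmom \<mu> k a c"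
  let ?q = "(opnorm ?I ?\<Delta>)\<^sup>2"
  define A where "A n = (if even n then (\<lambda>a c. cnj (?\<Delta> a c)) else (\<lambda>a c. ?\<Delta> c a))" for n :: nat
  define u where "u = rec_nat C (\<lambda>n. mmult ?I (A n))"
  have u0: "u 0 = C" and uS: "u (Suc n) = mmult ?I (A n) (u n)" for n
    by (simp_all add: u_def)
  define s where "s n = (L2norm \<mu> (tens_poly k (u n)))\<^sup>2" for n
  have adjoint: "L2_inner \<mu> (tens_poly k (mmult ?I (A n) X)) (tens_poly k Z)
      = L2_inner \<mu> (tens_poly k X) (tens_poly k (mmult ?I (A (Suc n)) Z))" for n X Z
    using moment_diff_adjoint[OF \<nu>] moment_diff_adjoint_transpose[OF \<nu>] by (simp add: A_def)
  have frob: "frob_sq ?I (u n) \<le> ?q ^ n * frob_sq ?I C" for n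
  proof (induction n)
    case (Suc n)
    have "frob_sq ?I (u (Suc n)) \<le> ?q * frob_sq ?I (u n)"
      unfolding uS
      using opnorm_bound_cnj[of ?I ?\<Delta>] opnorm_bound_transpose[of ?I ?\<Delta>]
      by (intro frob_sq_mmult_le, cases "even n") (simp_all add: A_def)
    also have "\<dots> \<le> ?q * (?q ^ n * frob_sq ?I C)"
      by (rule mult_left_mono[OF Suc]) simp
    finally show ?case by (simp add: mult_ac)
  qed (simp add: u0)
  have growth: "s n \<le> (real (card (?I \<times> ?I)) * frob_sq ?I C) * ?q ^ n" for n
  proof -
    have "s n \<le> real (card (?I \<times> ?I)) * frob_sq ?I (u n)"
      unfolding s_def by (rule L2norm_tens_poly_squared_le)
    also have "\<dots> \<le> real (card (?I \<times> ?I)) * (?q ^ n * frob_sq ?I C)"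
      by (intro mult_left_mono frob) simp
    finally show ?thesis by (simp add: mult_ac)
  qed
  have "s 1 \<le> ?q * s 0"
    using L2norm_adjoint_iterates_log_convex[where A = A and u = u, OF adjoint uS]
    by (intro log_convex_first_ratio_le[OF _ _ growth]) (simp_all add: s_def)
  then have "(L2norm \<mu> (tens_poly k (mmult ?I (\<lambda>a c. cnj (?\<Delta> a c)) C)))\<^sup>2
      \<le> (opnorm ?I ?\<Delta> * L2norm \<mu> (tens_poly k C))\<^sup>2"
    by (simp add: s_def u0 uS A_def power_mult_distrib)
  then show ?thesis
    by (rule power2_le_imp_le) (simp add: opnorm_nonneg L2norm_def)
qed

lemma Tnu_eq_mean_plus_moment_diff:
  assumes \<nu>: "unitary_prob_space \<nu>" and U: "unitary U"
    and \<Phi>: "\<And>V. unitary V \<Longrightarrow> \<Phi> V = tens_poly k C V" and "continuous_on UNIV \<Phi>"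
  shows "Tnu \<nu> \<Phi> U
    = (\<integral>V. \<Phi> V \<partial>\<mu>) + tens_poly k (mmult (idx k) (\<lambda>a c. cnj (Tmom \<nu> k a c - Tmom \<mu> k a c)) C) U"
proof -
  have "(\<integral>V. \<Phi> V \<partial>\<mu>) = (\<integral>V. tens_poly k C V \<partial>\<mu>)"
    by (rule integral_cong_unitary) (simp_all add: \<Phi> \<open>continuous_on UNIV \<Phi>\<close> continuous_intros)
  then show ?thesis
    using unitary_prob_space.Tnu_tens_poly[OF \<nu> U \<Phi> \<open>continuous_on UNIV \<Phi>\<close>]
    by (simp add: tens_poly_mmult_diff tens_poly_mmult_moment[OF U])
qed

end

theorem lemma3:
  fixes \<mu> \<nu> :: "(complex^'n^'n) measure" and \<Phi> :: "complex^'n^'n \<Rightarrow> complex"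
    and V :: "complex^'n^'n" and \<epsilon> \<delta> :: real and k :: nat
  assumes "haar \<mu>"
    and "prob_space \<nu>" and "sets \<nu> = sets borel" and "AE U in \<nu>. unitary U"
    and "approx_expander \<mu> \<nu> \<delta> k"
    and "unitary V" and "0 \<le> \<epsilon>" and "\<epsilon> \<le> 2"
    and "\<Phi> \<in> Hk k" and "(\<integral>U. \<Phi> U \<partial>\<mu>) = 1"
  shows "cmod ((LINT U : ballD V \<epsilon> | \<mu>. Tnu \<nu> \<Phi> U) - of_real (measure \<mu> (ballD V \<epsilon>)))
           \<le> \<delta> * sqrt (measure \<mu> (ballD V \<epsilon>)) * L2norm \<mu> \<Phi>"
proof -
  interpret haar_measure \<mu> by (rule haar_measureI) fact
  have \<nu>: "unitary_prob_space \<nu>"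
    using assms(2-4) by (simp add: unitary_prob_space_def unitary_prob_space_axioms_def)
  obtain C where \<Phi>: "\<And>U. unitary U \<Longrightarrow> \<Phi> U = tens_poly k C U"
    using Hk_eq_tens_poly[OF \<open>\<Phi> \<in> Hk k\<close>] by blast
  have "continuous_on UNIV \<Phi>"
    using \<open>\<Phi> \<in> Hk k\<close> by (rule Hk_continuous)
  define E where "E = tens_poly k (mmult (idx k) (\<lambda>a c. cnj (Tmom \<nu> k a c - Tmom \<mu> k a c)) C)"
  have "ballD V \<epsilon> \<in> sets \<mu>"
    using ballD_borel by (simp add: sets_eq_borel)
  then have ball: "cmod ((LINT U : ballD V \<epsilon> | \<mu>. Tnu \<nu> \<Phi> U) - measure \<mu> (ballD V \<epsilon>) *\<^sub>R 1)
      \<le> sqrt (measure \<mu> (ballD V \<epsilon>)) * L2norm \<mu> E"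
    using Tnu_eq_mean_plus_moment_diff[OF \<nu> _ \<Phi> \<open>continuous_on UNIV \<Phi>\<close>] \<open>(\<integral>U. \<Phi> U \<partial>\<mu>) = 1\<close>
    by (intro norm_set_integral_diff_measure_le) (auto simp: ballD_def E_def intro!: continuous_intros)
  have "L2norm \<mu> E \<le> opnorm (idx k) (\<lambda>a c. Tmom \<nu> k a c - Tmom \<mu> k a c) * L2norm \<mu> \<Phi>"
    using L2norm_moment_diff_le[OF \<nu>, of k C] L2norm_cong_unitary[OF \<Phi>]
    by (simp add: E_def \<open>continuous_on UNIV \<Phi>\<close> continuous_intros)
  also have "\<dots> \<le> \<delta> * L2norm \<mu> \<Phi>"
    using \<open>approx_expander \<mu> \<nu> \<delta> k\<close> unfolding approx_expander_def
    by (rule mult_right_mono) (simp add: L2norm_def)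
  finally have "sqrt (measure \<mu> (ballD V \<epsilon>)) * L2norm \<mu> E
      \<le> sqrt (measure \<mu> (ballD V \<epsilon>)) * (\<delta> * L2norm \<mu> \<Phi>)"
    by (rule mult_left_mono) simp
  then show ?thesis
    using ball by (simp add: scaleR_conv_of_real mult_ac)
qed

end
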